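(* Let $f$ be a rational function of degree $m\geq2$, regarded as a map $\mathbb{C}^*\to\mathbb{C}^*$ where $\mathbb{C}^*=\mathbb{C}\cup\{\infty\}$. Then the set $E_f=\{w\in\mathbb{C}^*:f(w)=\bar w\}$ contains at least $m-1$ points.
   Context: The complex conjugate of $\infty$ is defined to be $\infty$. The degree of $f=P/Q$, with $P,Q$ relatively prime polynomials, is $\max\{\deg P,\deg Q\}$. *)

theory Defs
  imports Complex_Main "HOL-Computational_Algebra.Polynomial"
begin

text \<open>The extended complex plane: \<open>None\<close> is the point at infinity.\<close>

type_synonym ext_complex = "complex option"

abbreviation infty :: ext_complex where
  "infty \<equiv> None"

definition ext_cnj :: "ext_complex \<Rightarrow> ext_complex" where
  "ext_cnj w = (case w of None \<Rightarrow> infty | Some z \<Rightarrow> Some (cnj z))"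

text \<open>
  The map of the extended plane given by \<open>P / Q\<close>, meaningful for coprime \<open>P\<close>, \<open>Q\<close> with
  \<open>Q \<noteq> 0\<close>. The poles are the zeros of \<open>Q\<close>, and the value at infinity is the limit of
  \<open>P z / Q z\<close> as \<open>z\<close> tends to infinity.
\<close>

definition quotient_map :: "complex poly \<Rightarrow> complex poly \<Rightarrow> ext_complex \<Rightarrow> ext_complex" where
  "quotient_map P Q w =
     (case w of
        Some z \<Rightarrow> if poly Q z = 0 then infty else Some (poly P z / poly Q z)
      | None \<Rightarrow>
          if degree P > degree Q then infty
          else if degree P < degree Q then Some 0
          else Some (lead_coeff P / lead_coeff Q))"

definition rational_function_of_degree :: "(ext_complex \<Rightarrow> ext_complex) \<Rightarrow> nat \<Rightarrow> bool" where
  "rational_function_of_degree f m \<longleftrightarrow>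
     (\<exists>P Q. Q \<noteq> 0 \<and> coprime P Q \<and> m = max (degree P) (degree Q) \<and> f = quotient_map P Q)"

definition E_set :: "(ext_complex \<Rightarrow> ext_complex) \<Rightarrow> ext_complex set" where
  "E_set f = {w. f w = ext_cnj w}"

end

theory Submission
  imports Defs "HOL-Analysis.Analysis"
begin

text \<open>
  A point \<open>a\<close> with \<open>f a \<noteq> cnj a\<close> is moved to infinity by \<open>z = a + 1 / u\<close>. The set \<open>E_set f\<close> then
  becomes the zero set of a function \<open>K u = cnj u * Q u - P u\<close> with polynomials \<open>P\<close>, \<open>Q\<close> without common
  zeros, and \<open>K u / (cnj u * u ^ m)\<close> has a nonzero limit at infinity, so \<open>K\<close> winds \<open>m - 1\<close> times
  around \<open>0\<close> along large circles. The sum of the local indices of the zeros of \<open>K\<close> is therefore \<open>m - 1\<close>,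
  and it remains to see that each local index is at most \<open>1\<close>. Near a zero, \<open>K\<close> is a nonvanishing
  factor times \<open>cnj u - P u / Q u\<close>, whose real derivative is never zero. After multiplication by a
  suitable constant, the real part has a nonzero linear part, hence at most two zeros on each small
  circle, whereas a loop of index \<open>n\<close> meets the imaginary axis at least \<open>2 * n\<close> times.
\<close>

text \<open>
  For a continuous \<open>\<phi>\<close> without zeros on the circle, \<open>n\<close> is the winding number of its image around \<open>0\<close>;
  the factor \<open>exp (g z)\<close> expresses that the remaining part of \<open>\<phi>\<close> has a continuous logarithm.
\<close>

definition circle_index :: "(complex \<Rightarrow> complex) \<Rightarrow> complex \<Rightarrow> real \<Rightarrow> int \<Rightarrow> bool" where
  "circle_index \<phi> c r n \<longleftrightarrow>
     (\<exists>g. continuous_on (sphere c r) g \<and> (\<forall>z\<in>sphere c r. \<phi> z = (z - c) powi n * exp (g z)))"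

section \<open>Calculus of the circle index\<close>

lemma circle_index_cong:
  assumes "circle_index \<phi> c r n" "\<And>z. z \<in> sphere c r \<Longrightarrow> \<psi> z = \<phi> z"
  shows "circle_index \<psi> c r n"
  using assms by (auto simp: circle_index_def)

lemma circle_index_mult:
  assumes "circle_index \<phi> c r m" "circle_index \<psi> c r n" "r > 0"
  shows "circle_index (\<lambda>z. \<phi> z * \<psi> z) c r (m + n)"
proof -
  obtain g h where gh: "continuous_on (sphere c r) g" "continuous_on (sphere c r) h"
    and eq: "\<And>z. z \<in> sphere c r \<Longrightarrow> \<phi> z = (z - c) powi m * exp (g z)"
      "\<And>z. z \<in> sphere c r \<Longrightarrow> \<psi> z = (z - c) powi n * exp (h z)"
    using assms by (auto simp: circle_index_def)
  have "\<phi> z * \<psi> z = (z - c) powi (m + n) * exp (g z + h z)" if "z \<in> sphere c r" for z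
  proof -
    have "z - c \<noteq> 0"
      using that \<open>r > 0\<close> by auto
    then show ?thesis
      using eq[OF that] by (simp add: power_int_add exp_add)
  qed
  then show ?thesis
    unfolding circle_index_def using gh by (intro exI[of _ "\<lambda>z. g z + h z"]) (auto intro: continuous_intros)
qed

lemma circle_index_inverse:
  assumes "circle_index \<phi> c r n"
  shows "circle_index (\<lambda>z. inverse (\<phi> z)) c r (- n)"
proof -
  obtain g where g: "continuous_on (sphere c r) g"
    and eq: "\<And>z. z \<in> sphere c r \<Longrightarrow> \<phi> z = (z - c) powi n * exp (g z)"
    using assms by (auto simp: circle_index_def)
  have "inverse (\<phi> z) = (z - c) powi (- n) * exp (- g z)" if "z \<in> sphere c r" for z
    using eq[OF that] by (simp add: power_int_minus exp_minus)
  then show ?thesis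
    unfolding circle_index_def using g by (intro exI[of _ "\<lambda>z. - g z"]) (auto intro: continuous_intros)
qed

lemma circle_index_exp:
  assumes "continuous_on (sphere c r) g" "\<And>z. z \<in> sphere c r \<Longrightarrow> \<phi> z = exp (g z)"
  shows "circle_index \<phi> c r 0"
  unfolding circle_index_def using assms by auto

lemma circle_index_powi: "circle_index (\<lambda>z. (z - c) powi n) c r n"
  unfolding circle_index_def by (intro exI[of _ "\<lambda>_. 0"]) auto

lemma circle_index_const:
  assumes "a \<noteq> 0"
  shows "circle_index (\<lambda>_. a) c r 0"
  using assms by (intro circle_index_exp[where g = "\<lambda>_. Ln a"]) auto

lemma circle_index_cball:
  assumes "continuous_on (cball c r) \<phi>" "\<And>z. z \<in> cball c r \<Longrightarrow> \<phi> z \<noteq> 0"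
  shows "circle_index \<phi> c r 0"
proof -
  obtain h where h: "continuous_on (cball c r) h" "\<And>z. z \<in> cball c r \<Longrightarrow> \<phi> z = exp (h z)"
    using continuous_logarithm_on_cball[OF assms] by blast
  have "continuous_on (sphere c r) h"
    by (rule continuous_on_subset[OF h(1)]) auto
  then show ?thesis
    by (rule circle_index_exp) (use h in auto)
qed

text \<open>The quotient \<open>\<phi> z / L\<close> stays within distance less than 1 of 1, hence
  in the right half-plane, where \<open>Ln\<close> is continuous.\<close>

lemma circle_index_near_const:
  assumes "continuous_on (sphere c r) \<phi>" "\<And>z. z \<in> sphere c r \<Longrightarrow> cmod (\<phi> z - L) < cmod L"
  shows "circle_index \<phi> c r 0"
proof (cases "L = 0")
  case False
  have pos: "Re (\<phi> z / L) > 0" if "z \<in> sphere c r" for z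
  proof -
    have "cmod (\<phi> z / L - 1) = cmod (\<phi> z - L) / cmod L"
      using False by (simp add: divide_simps flip: norm_divide)
    then have "cmod (\<phi> z / L - 1) < 1"
      using assms(2)[OF that] False by simp
    then show ?thesis
      using abs_Re_le_cmod[of "\<phi> z / L - 1"] by simp
  qed
  show ?thesis
  proof (rule circle_index_exp[where g = "\<lambda>z. Ln L + Ln (\<phi> z / L)"])
    show "continuous_on (sphere c r) (\<lambda>z. Ln L + Ln (\<phi> z / L))"
      using assms(1) pos False by (fastforce intro!: continuous_intros simp: complex_nonpos_Reals_iff)
    show "\<phi> z = exp (Ln L + Ln (\<phi> z / L))" if "z \<in> sphere c r" for z
    proof -
      have "\<phi> z / L \<noteq> 0"
        using pos[OF that] by force
      then show ?thesis
        using False by (simp add: exp_add)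
    qed
  qed
next
  case True
  then have "sphere c r = {}"
    using assms(2) by (metis norm_ge_zero norm_zero not_less equals0I)
  then show ?thesis by (simp add: circle_index_def)
qed

section \<open>Zeros of the real part and uniqueness of the index\<close>

text \<open>The lifted argument of \<open>\<phi>\<close> grows by \<open>2 * pi * n\<close> over one
  turn, so by the intermediate value theorem it takes \<open>2 * nat n\<close> consecutive odd
  multiples of \<open>pi / 2\<close> as values, and there the real part vanishes.\<close>

lemma circle_index_imp_Re_zeros:
  assumes "circle_index \<phi> c r n" "r > 0" "n \<ge> 0"
  obtains A where "A \<subseteq> {z \<in> sphere c r. Re (\<phi> z) = 0}" "finite A" "card A = 2 * nat n"
proof -
  obtain g where g: "continuous_on (sphere c r) g"
    and eq: "\<And>z. z \<in> sphere c r \<Longrightarrow> \<phi> z = (z - c) powi n * exp (g z)"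
    using assms by (auto simp: circle_index_def)
  define \<gamma> where "\<gamma> \<equiv> \<lambda>\<theta>::real. c + of_real r * exp (\<i> * of_real \<theta>)"
  define a where "a \<equiv> \<lambda>\<theta>. real_of_int n * \<theta> + Im (g (\<gamma> \<theta>))"
  \<comment> \<open>\<open>j\<close> is the least integer with
    \<open>a 0 \<le> pi / 2 + j * pi\<close>, so the \<open>v k\<close> with
    \<open>k < 2 * nat n\<close> lie in the half-open interval from \<open>a 0\<close> to
    \<open>a (2 * pi)\<close>.\<close>
  define j where "j = \<lceil>(a 0 - pi/2) / pi\<rceil>"
  define v where "v \<equiv> \<lambda>k::nat. pi / 2 + (of_int j + real k) * pi"
  have sph: "\<gamma> \<theta> \<in> sphere c r" for \<theta>
    using assms(2) by (auto simp: \<gamma>_def dist_norm norm_mult)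
  have cont: "continuous_on {0..2*pi} a"
    unfolding a_def \<gamma>_def
    by (intro continuous_intros continuous_on_compose2[OF g]) (use sph in \<open>auto simp: \<gamma>_def\<close>)
  have "\<gamma> (2 * pi) = \<gamma> 0"
    using exp_two_pi_i by (simp add: \<gamma>_def mult_ac)
  then have a2pi: "a (2 * pi) = a 0 + 2 * pi * n"
    by (simp add: a_def)
  have j1: "(a 0 - pi/2) / pi \<le> of_int j" "of_int j < (a 0 - pi/2) / pi + 1"
    unfolding j_def by linarith+
  have vlo: "a 0 \<le> v k" for k
  proof -
    have "a 0 - pi/2 \<le> of_int j * pi" using j1(1) by (simp add: pos_divide_le_eq)
    moreover have "0 \<le> real k * pi" by simp
    ultimately show ?thesis unfolding v_def distrib_right by linarith
  qed
  have vhi: "v k < a (2 * pi)" if "k < 2 * nat n" for k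
  proof -
    have "of_int j * pi < a 0 - pi/2 + pi" using j1(2) by (simp add: field_simps)
    moreover have "real k + 1 \<le> 2 * n" using that assms(3) by linarith
    then have "(real k + 1) * pi \<le> 2 * n * pi" by (intro mult_right_mono) auto
    ultimately show ?thesis unfolding v_def a2pi by (simp add: algebra_simps)
  qed
  \<comment> \<open>The strict bound \<open>\<theta> < 2 * pi\<close> keeps the parameters in one
    period, so that different \<open>k\<close> give different points of the circle.\<close>
  have "\<exists>\<theta>. 0 \<le> \<theta> \<and> \<theta> < 2 * pi \<and> a \<theta> = v k" if "k < 2 * nat n" for k
  proof -
    have "\<exists>\<theta>\<ge>0. \<theta> \<le> 2 * pi \<and> a \<theta> = v k"
      using IVT'[OF vlo[of k] less_imp_le[OF vhi[OF that]] _ cont] by simp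
    then show ?thesis
      using vhi[OF that] by (metis less_irrefl order_le_less)
  qed
  then obtain t where t: "\<And>k. k < 2 * nat n \<Longrightarrow> 0 \<le> t k \<and> t k < 2 * pi \<and> a (t k) = v k"
    by metis
  have "inj_on (\<lambda>k. \<gamma> (t k)) {..<2 * nat n}"
  proof (rule inj_onI)
    fix k l assume kl: "k \<in> {..<2 * nat n}" "l \<in> {..<2 * nat n}" "\<gamma> (t k) = \<gamma> (t l)"
    then have "exp (\<i> * of_real (t k)) = exp (\<i> * of_real (t l))"
      using assms(2) by (simp add: \<gamma>_def)
    then have "Arg2pi (exp (\<i> * of_real (t k))) = Arg2pi (exp (\<i> * of_real (t l)))"
      by simp
    then have "t k = t l"
      using t[of k] t[of l] kl by (simp add: Arg2pi_exp)
    then have "v k = v l" using t[of k] t[of l] kl by auto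
    then show "k = l" by (simp add: v_def)
  qed
  then have "card ((\<lambda>k. \<gamma> (t k)) ` {..<2 * nat n}) = 2 * nat n"
    by (simp add: card_image)
  moreover have "Re (\<phi> (\<gamma> (t k))) = 0" if "k < 2 * nat n" for k
  proof -
    \<comment> \<open>Written as an exponential, \<open>z - c\<close> has its power \<open>n\<close>
      computed in the exponent; the real number \<open>ln r\<close> does not affect the imaginary
      part.\<close>
    have \<gamma>: "\<gamma> (t k) - c = exp (of_real (ln r) + \<i> * of_real (t k))"
      using assms(2) by (simp add: \<gamma>_def exp_add exp_of_real)
    have "\<phi> (\<gamma> (t k)) = exp (of_int n * (of_real (ln r) + \<i> * of_real (t k)) + g (\<gamma> (t k)))"
      using eq[OF sph, of "t k"] unfolding \<gamma> exp_power_int by (simp only: exp_add)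
    moreover have "Im (of_int n * (of_real (ln r) + \<i> * of_real (t k)) + g (\<gamma> (t k))) = v k"
      using t[OF that] by (simp add: a_def)
    moreover have "cos (v k) = 0"
    proof -
      have "v k = pi / 2 + of_int (j + int k) * pi" by (simp add: v_def)
      moreover have "sin (of_int (j + int k) * pi) = 0"
        using sin_zero_iff_int2 by blast
      ultimately show ?thesis by (simp only: cos_add cos_pi_half)
    qed
    ultimately show ?thesis by (simp only: Re_exp)
  qed
  ultimately show thesis
    using sph by (intro that[of "(\<lambda>k. \<gamma> (t k)) ` {..<2 * nat n}"]) auto
qed

text \<open>A constant function has no index other than \<open>0\<close>, since the real part of \<open>1\<close> has no zeros.\<close>

lemma circle_index_unique:
  assumes "circle_index \<phi> c r m" "circle_index \<phi> c r n" "r > 0"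
  shows "m = n"
proof -
  have le: "k \<le> l" if kl: "circle_index \<phi> c r k" "circle_index \<phi> c r l" for k l
  proof (rule ccontr)
    assume "\<not> k \<le> l"
    have nz: "\<phi> z \<noteq> 0" if "z \<in> sphere c r" for z
      using kl(1) that \<open>r > 0\<close> by (auto simp: circle_index_def power_int_eq_0_iff)
    have "circle_index (\<lambda>z. \<phi> z * inverse (\<phi> z)) c r (k + - l)"
      by (intro circle_index_mult circle_index_inverse kl assms)
    then have "circle_index (\<lambda>_. 1) c r (k + - l)"
      by (rule circle_index_cong) (use nz in auto)
    then obtain A where "A \<subseteq> {z \<in> sphere c r. Re (1::complex) = 0}" "card A = 2 * nat (k + - l)"
      by (rule circle_index_imp_Re_zeros) (use assms \<open>\<not> k \<le> l\<close> in auto)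
    then show False using \<open>\<not> k \<le> l\<close> by auto
  qed
  show ?thesis using le[OF assms(1,2)] le[OF assms(2,1)] by simp
qed

section \<open>Existence of the index\<close>

text \<open>A logarithm \<open>G\<close> along the parametrized circle has end values differing by a
  multiple of \<open>2 * pi * \<i>\<close>. Subtracting a linear term closes the path, and that term
  becomes the power of \<open>z\<close>.\<close>

lemma circle_index_unit_exists:
  assumes "continuous_on (sphere 0 1) \<phi>" "\<And>z. z \<in> sphere 0 1 \<Longrightarrow> \<phi> z \<noteq> 0"
  shows "\<exists>n. circle_index \<phi> 0 1 n"
proof -
  define e where "e \<equiv> \<lambda>t::real. exp (2 * of_real pi * of_real t * \<i>)"
  have e_sph: "e t \<in> sphere 0 1" for t
    by (simp add: e_def)
  have "continuous_on {0..1} (\<lambda>t. \<phi> (e t))"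
    by (rule continuous_on_compose2[OF assms(1)]) (use e_sph in \<open>auto simp: e_def intro!: continuous_intros\<close>)
  then obtain G where G: "continuous_on {0..1} G" "\<And>t. t \<in> {0..1} \<Longrightarrow> \<phi> (e t) = exp (G t)"
    using continuous_logarithm_on_contractible[of "{0..1::real}" "\<lambda>t. \<phi> (e t)"] assms(2) e_sph
      convex_imp_contractible[of "{0..1::real}"] by blast
  have "e 1 = e 0"
    by (simp add: e_def mult_ac)
  then have "exp (G 1) = exp (G 0)"
    using G(2)[of 0] G(2)[of 1] by simp
  then obtain n :: int where n: "G 1 = G 0 + of_int (2 * n) * of_real pi * \<i>"
    by (auto simp: exp_eq)
  define p where "p \<equiv> \<lambda>t::real. G t - of_int (2 * n) * of_real (pi * t) * \<i>"
  have contp: "continuous_on {0..1} p"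
    unfolding p_def by (intro continuous_intros G)
  \<comment> \<open>The homotopy of \<open>p\<close> with itself serves to turn the loop into a
    continuous map on the circle, although \<open>Arg2pi\<close> jumps there.\<close>
  have "homotopic_loops UNIV p p"
    using contp n by (auto simp: homotopic_loops_refl path_def pathstart_def pathfinish_def p_def)
  then have "homotopic_with_canon (\<lambda>h. True) (sphere 0 1) UNIV
      (p \<circ> (\<lambda>z. Arg2pi z / (2 * pi))) (p \<circ> (\<lambda>z. Arg2pi z / (2 * pi)))"
    by (rule homotopic_loops_imp_homotopic_circlemaps)
  then have "continuous_on (sphere 0 1) (p \<circ> (\<lambda>z. Arg2pi z / (2 * pi)))"
    using homotopic_with_imp_continuous by blast
  moreover have "\<phi> z = (z - 0) powi n * exp ((p \<circ> (\<lambda>z. Arg2pi z / (2 * pi))) z)" if "z \<in> sphere 0 1" for z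
  proof -
    define t where "t = Arg2pi z / (2 * pi)"
    have t: "t \<in> {0..1}"
      using Arg2pi_ge_0[of z] Arg2pi_lt_2pi[of z] by (auto simp: t_def divide_simps)
    have z: "z = e t"
      using that Arg2pi_eq[of z] by (simp add: e_def t_def mult_ac)
    have "z powi n = exp (of_int (2 * n) * of_real (pi * t) * \<i>)"
      unfolding z e_def by (simp add: exp_power_int mult_ac)
    moreover have "\<phi> z = exp (G t)"
      using G(2)[OF t] z by simp
    ultimately show ?thesis
      by (simp add: p_def exp_diff flip: t_def)
  qed
  ultimately show ?thesis
    unfolding circle_index_def by blast
qed

lemma circle_index_exists:
  assumes "continuous_on (sphere c r) \<phi>" "\<And>z. z \<in> sphere c r \<Longrightarrow> \<phi> z \<noteq> 0" "r > 0"
  shows "\<exists>n. circle_index \<phi> c r n"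
proof -
  have sph: "c + of_real r * w \<in> sphere c r" if "w \<in> sphere 0 1" for w
    using that \<open>r > 0\<close> by (auto simp: dist_norm norm_mult)
  have "continuous_on (sphere 0 1) (\<lambda>w. \<phi> (c + of_real r * w))"
    by (rule continuous_on_compose2[OF assms(1)]) (use sph in \<open>auto intro!: continuous_intros\<close>)
  then obtain n where "circle_index (\<lambda>w. \<phi> (c + of_real r * w)) 0 1 n"
    using circle_index_unit_exists[of "\<lambda>w. \<phi> (c + of_real r * w)"] assms(2) sph by blast
  then obtain g where g: "continuous_on (sphere 0 1) g"
    "\<And>w. w \<in> sphere 0 1 \<Longrightarrow> \<phi> (c + of_real r * w) = w powi n * exp (g w)"
    by (auto simp: circle_index_def)
  have sph': "(z - c) / of_real r \<in> sphere 0 1" if "z \<in> sphere c r" for z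
    using that \<open>r > 0\<close> by (auto simp: dist_norm norm_divide norm_minus_commute)
  have "circle_index (\<lambda>z. (z - c) powi n * of_real r powi (- n) * exp (g ((z - c) / of_real r))) c r (n + 0 + 0)"
  proof (intro circle_index_mult circle_index_powi circle_index_const)
    show "circle_index (\<lambda>z. exp (g ((z - c) / of_real r))) c r 0"
      using \<open>r > 0\<close> sph'
      by (intro circle_index_exp[where g = "\<lambda>z. g ((z - c) / of_real r)"] continuous_on_compose2[OF g(1)])
        (auto intro!: continuous_intros)
  qed (use \<open>r > 0\<close> in auto)
  then have "circle_index \<phi> c r (n + 0 + 0)"
  proof (rule circle_index_cong)
    fix z assume z: "z \<in> sphere c r"
    have "c + of_real r * ((z - c) / of_real r) = z" using \<open>r > 0\<close> by simp
    then show "\<phi> z = (z - c) powi n * of_real r powi (- n) * exp (g ((z - c) / of_real r))"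
      using g(2)[OF sph'[OF z]] by (simp add: power_int_divide_distrib power_int_minus power_int_mult_distrib power_int_inverse divide_inverse)
  qed
  then show ?thesis by blast
qed

section \<open>Local index at most one\<close>

text \<open>The bounds \<open>r / 2\<close> and the sign condition put both points on the same arc,
  at the top or at the bottom, where chords satisfy
  \<open>\<bar>y1 - y2\<bar> \<le> \<bar>x1 - x2\<bar>\<close>. The inequality between squares makes
  the chord steeper than that unless the points coincide.\<close>

lemma two_points_on_circle_eq:
  fixes x1 y1 x2 y2 r :: real
  assumes "r > 0" "x1\<^sup>2 + y1\<^sup>2 = r\<^sup>2" "x2\<^sup>2 + y2\<^sup>2 = r\<^sup>2" "\<bar>x1\<bar> \<le> r / 2" "\<bar>x2\<bar> \<le> r / 2"
    and "(x1 - x2)\<^sup>2 \<le> ((x1 - x2)\<^sup>2 + (y1 - y2)\<^sup>2) / 4" and "y1 > 0 \<longleftrightarrow> y2 > 0"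
  shows "x1 = x2 \<and> y1 = y2"
proof -
  have y: "\<bar>y\<bar> \<ge> r / 2" if "x\<^sup>2 + y\<^sup>2 = r\<^sup>2" "\<bar>x\<bar> \<le> r / 2" for x y :: real
  proof -
    have "x\<^sup>2 \<le> (r / 2)\<^sup>2"
      using that(2) \<open>r > 0\<close> by (intro power2_le_iff_abs_le[THEN iffD2]) auto
    then have "(r / 2)\<^sup>2 \<le> y\<^sup>2"
      using that(1) zero_le_power2[of r] unfolding power_divide by (simp, linarith)
    then have "\<bar>r / 2\<bar> \<le> \<bar>y\<bar>"
      by (simp only: abs_le_square_iff)
    then show ?thesis using \<open>r > 0\<close> by simp
  qed
  have "\<bar>y1 + y2\<bar> \<ge> r"
    using y[OF assms(2,4)] y[OF assms(3,5)] assms(7) by linarith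
  moreover have "\<bar>x1 + x2\<bar> \<le> r"
    using assms(4,5) by linarith
  moreover have "(y1 - y2) * (y1 + y2) = - ((x1 - x2) * (x1 + x2))"
    using assms(2,3) by (simp add: algebra_simps power2_eq_square)
  then have "\<bar>y1 - y2\<bar> * \<bar>y1 + y2\<bar> = \<bar>x1 - x2\<bar> * \<bar>x1 + x2\<bar>"
    by (metis abs_minus_cancel abs_mult)
  ultimately have "\<bar>y1 - y2\<bar> * r \<le> \<bar>x1 - x2\<bar> * r"
    by (metis abs_ge_zero mult_left_mono order.trans)
  then have "\<bar>y1 - y2\<bar> \<le> \<bar>x1 - x2\<bar>"
    using \<open>r > 0\<close> by simp
  then have le: "(y1 - y2)\<^sup>2 \<le> (x1 - x2)\<^sup>2"
    by (simp add: abs_le_square_iff)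
  moreover have "X \<le> 0" if "Y \<le> X" "X \<le> (X + Y) / 4" for X Y :: real
    using that by simp
  ultimately have "(x1 - x2)\<^sup>2 \<le> 0"
    using assms(6) by blast
  then show ?thesis
    using le by auto
qed

text \<open>By \<open>strict\<close>, a chord between two zeros of \<open>Re (h z)\<close> makes an
  angle of at most 30 degrees with the line \<open>Re (\<mu> * u) = 0\<close>. So the zeros on the
  circle lie on two opposite arcs, at most one on each, whereas an index of at least 2 would force
  four.\<close>

lemma circle_index_le_one:
  assumes "h c = 0" and "\<mu> \<noteq> 0" and "0 < r"
    and strict: "\<And>z w. z \<in> cball c r \<Longrightarrow> w \<in> cball c r \<Longrightarrow>
      \<bar>Re (h z - h w) - Re (\<mu> * (z - w))\<bar> \<le> cmod \<mu> / 2 * cmod (z - w)"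
    and "circle_index h c r n"
  shows "n \<le> 1"
proof (rule ccontr)
  assume "\<not> n \<le> 1"
  then obtain A where A: "A \<subseteq> {z \<in> sphere c r. Re (h z) = 0}" "finite A" "card A = 2 * nat n"
    using circle_index_imp_Re_zeros[OF assms(5,3)] by force
  define p where "p \<equiv> \<lambda>z. sgn \<mu> * (z - c)"
  have sgn1: "cmod (sgn \<mu>) = 1"
    using \<open>\<mu> \<noteq> 0\<close> by (simp add: norm_sgn)
  have bound: "\<bar>Re (p z - p w)\<bar> \<le> cmod (z - w) / 2"
    if "z \<in> cball c r" "w \<in> cball c r" "Re (h z) = 0" "Re (h w) = 0" for z w
  proof -
    have "\<mu> = of_real (cmod \<mu>) * sgn \<mu>"
      using \<open>\<mu> \<noteq> 0\<close> by (simp add: sgn_div_norm scaleR_conv_of_real)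
    moreover have "p z - p w = sgn \<mu> * (z - w)"
      by (simp add: p_def algebra_simps)
    ultimately have "\<mu> * (z - w) = of_real (cmod \<mu>) * (p z - p w)"
      by (metis mult.assoc)
    moreover have "Re (of_real a * u) = a * Re u" for a u
      by simp
    ultimately have "\<bar>Re (\<mu> * (z - w))\<bar> = cmod \<mu> * \<bar>Re (p z - p w)\<bar>"
      by (simp only: abs_mult abs_norm_cancel)
    then have "cmod \<mu> * \<bar>Re (p z - p w)\<bar> \<le> cmod \<mu> * (cmod (z - w) / 2)"
      using strict[OF that(1,2)] that(3,4) by (simp only: minus_complex.sel(1))
    then show ?thesis
      using \<open>\<mu> \<noteq> 0\<close> by simp
  qed
  have norm_p: "cmod (p z - p w) = cmod (z - w)" for z w
  proof -
    have "p z - p w = sgn \<mu> * (z - w)" by (simp add: p_def algebra_simps)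
    then show ?thesis by (simp add: norm_mult sgn1)
  qed
  have pc: "p c = 0" by (simp add: p_def)
  have "inj_on (\<lambda>z. Im (p z) > 0) A"
  proof (rule inj_onI)
    fix z w assume zw: "z \<in> A" "w \<in> A" "(Im (p z) > 0) = (Im (p w) > 0)"
    then have mem: "z \<in> sphere c r" "w \<in> sphere c r" and Re0: "Re (h z) = 0" "Re (h w) = 0"
      using A(1) by auto
    have Re_le: "\<bar>Re (p u)\<bar> \<le> r / 2" and circ: "(Re (p u))\<^sup>2 + (Im (p u))\<^sup>2 = r\<^sup>2"
      if "u \<in> sphere c r" "Re (h u) = 0" for u
    proof -
      have "cmod (u - c) = r" using that by (simp add: dist_norm norm_minus_commute)
      \<comment> \<open>The centre is itself a zero of \<open>h\<close>, so \<open>bound\<close>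
        applies to the pair \<open>u\<close>, \<open>c\<close>.\<close>
      then show "\<bar>Re (p u)\<bar> \<le> r / 2" "(Re (p u))\<^sup>2 + (Im (p u))\<^sup>2 = r\<^sup>2"
        using bound[of u c] that \<open>h c = 0\<close> \<open>0 < r\<close> norm_p[of u c] cmod_power2[of "p u"] by (auto simp: pc)
    qed
    have "\<bar>Re (p z - p w)\<bar> \<le> cmod (p z - p w) / 2"
      using bound[of z w] mem Re0 by (simp add: norm_p)
    then have "\<bar>Re (p z - p w)\<bar>\<^sup>2 \<le> (cmod (p z - p w) / 2)\<^sup>2"
      by (intro power_mono) auto
    then have "(Re (p z) - Re (p w))\<^sup>2 \<le> ((Re (p z) - Re (p w))\<^sup>2 + (Im (p z) - Im (p w))\<^sup>2) / 4"
      by (simp add: power_divide cmod_power2)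
    then have "Re (p z) = Re (p w) \<and> Im (p z) = Im (p w)"
      using two_points_on_circle_eq[OF \<open>0 < r\<close> circ circ Re_le Re_le _ zw(3)] mem Re0 by blast
    then have "cmod (p z - p w) = 0"
      by (simp add: complex_eq_iff)
    then show "z = w" by (simp add: norm_p)
  qed
  then have "card A \<le> card (UNIV :: bool set)"
    by (rule card_inj_on_le) auto
  then show False
    using A(3) \<open>\<not> n \<le> 1\<close> by simp
qed

section \<open>Removing zeros and the index at infinity\<close>

text \<open>Asking only for arbitrarily small circles, with \<open>n\<close> allowed to vary with
  \<open>r\<close>, spares a proof that the local index is independent of the radius.\<close>

definition zero_index_le_one :: "(complex \<Rightarrow> complex) \<Rightarrow> complex \<Rightarrow> bool" where
  "zero_index_le_one \<phi> c \<longleftrightarrow> (\<forall>\<epsilon>>0. \<exists>r n. 0 < r \<and> r < \<epsilon> \<and> n \<le> 1 \<and> circle_index \<phi> c r n)"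

text \<open>On the circle \<open>z - a = z * (1 - a / z)\<close>, and the second factor has a
  continuous logarithm because \<open>a / z\<close> has modulus below 1.\<close>

lemma circle_index_shift:
  assumes "cmod a < R"
  shows "circle_index (\<lambda>z. (z - a) powi n) 0 R n"
proof -
  have R: "0 < R" using assms norm_ge_zero[of a] by linarith
  have "circle_index (\<lambda>z. 1 - a / z) 0 R 0"
  proof (rule circle_index_near_const[where L = 1])
    show "continuous_on (sphere 0 R) (\<lambda>z. 1 - a / z)"
      using R by (intro continuous_intros) auto
    show "cmod (1 - a / z - 1) < cmod 1" if "z \<in> sphere 0 R" for z
      using that assms R by (simp add: norm_divide)
  qed
  then obtain g where g: "continuous_on (sphere 0 R) g" "\<And>z. z \<in> sphere 0 R \<Longrightarrow> 1 - a / z = exp (g z)"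
    by (auto simp: circle_index_def)
  have "(z - a) powi n = (z - 0) powi n * exp (of_int n * g z)" if "z \<in> sphere 0 R" for z
  proof -
    have "z \<noteq> 0" using that R by auto
    then have "z - a = z * exp (g z)"
      by (simp flip: g(2)[OF that] add: field_simps)
    then show ?thesis
      by (simp add: power_int_mult_distrib exp_power_int)
  qed
  then show ?thesis
    unfolding circle_index_def
    by (intro exI[of _ "\<lambda>z. of_int n * g z"]) (auto intro!: continuous_intros g)
qed

text \<open>A zero-free factor has index 0. This carries the bound at the other zeros through the
  removal of one zero.\<close>

lemma zero_index_le_one_transfer:
  assumes "zero_index_le_one \<phi> c" "0 < \<delta>"
    and "continuous_on (cball c \<delta>) \<beta>" "\<And>z. z \<in> cball c \<delta> \<Longrightarrow> \<beta> z \<noteq> 0"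
    and eq: "\<And>z. z \<in> cball c \<delta> \<Longrightarrow> \<psi> z = \<phi> z * \<beta> z"
  shows "zero_index_le_one \<psi> c"
  unfolding zero_index_le_one_def
proof (intro allI impI)
  fix \<epsilon> :: real assume "\<epsilon> > 0"
  then obtain r n where r: "0 < r" "r < min \<epsilon> \<delta>" "n \<le> 1" "circle_index \<phi> c r n"
    using assms(1,2) unfolding zero_index_le_one_def by (metis min_less_iff_conj)
  have sub: "cball c r \<subseteq> cball c \<delta>" using r by auto
  have "circle_index \<beta> c r 0"
    using sub assms(3,4) by (intro circle_index_cball) (auto intro: continuous_on_subset)
  then have "circle_index (\<lambda>z. \<phi> z * \<beta> z) c r (n + 0)"
    using r by (intro circle_index_mult) auto
  then have "circle_index \<psi> c r (n + 0)"
    by (rule circle_index_cong) (use r eq in auto)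
  then show "\<exists>r n. 0 < r \<and> r < \<epsilon> \<and> n \<le> 1 \<and> circle_index \<psi> c r n"
    using r by auto
qed

lemma circle_index_extend:
  assumes "continuous_on UNIV \<phi>" "circle_index \<phi> c r n" "0 < r"
    and nz: "\<And>z. z \<in> cball c r \<Longrightarrow> \<phi> z = 0 \<Longrightarrow> z = c"
  obtains \<psi> where "continuous_on UNIV \<psi>" "\<And>z. z \<in> cball c r \<Longrightarrow> \<psi> z \<noteq> 0"
    "\<And>z. z \<notin> ball c r \<Longrightarrow> \<psi> z = \<phi> z * (z - c) powi (- n)"
proof -
  obtain g where g: "continuous_on (sphere c r) g"
    and eq: "\<And>z. z \<in> sphere c r \<Longrightarrow> \<phi> z = (z - c) powi n * exp (g z)"
    using assms by (auto simp: circle_index_def)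
  have "bounded (g ` sphere c r)"
    by (intro compact_imp_bounded compact_continuous_image g) auto
  then obtain B where "B > 0" "\<And>z. z \<in> sphere c r \<Longrightarrow> cmod (g z) \<le> B"
    by (auto simp: bounded_pos)
  then obtain G where G: "continuous_on UNIV G" "\<And>z. z \<in> sphere c r \<Longrightarrow> G z = g z"
    using Tietze[of "sphere c r" g UNIV B] g by (metis UNIV_I closed_closedin closed_sphere less_imp_le subtopology_UNIV)
  define \<psi> where "\<psi> \<equiv> \<lambda>z. if z \<in> cball c r then exp (G z) else \<phi> z * (z - c) powi (- n)"
  \<comment> \<open>Agreement on the circle glues the two pieces continuously and lets the outer
    formula include the boundary.\<close>
  have agree: "exp (G z) = \<phi> z * (z - c) powi (- n)" if "z \<in> sphere c r" for z
  proof -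
    have "z - c \<noteq> 0" using that \<open>0 < r\<close> by auto
    then show ?thesis
      using eq[OF that] G(2)[OF that] by (simp add: power_int_minus)
  qed
  have "continuous_on (cball c r \<union> - ball c r) \<psi>"
    unfolding \<psi>_def
  proof (rule continuous_on_If)
    show "continuous_on (- ball c r) (\<lambda>z. \<phi> z * (z - c) powi (- n))"
      using \<open>0 < r\<close>
      by (intro continuous_intros continuous_on_subset[OF assms(1)]) auto
    show "continuous_on (cball c r) (\<lambda>z. exp (G z))"
      by (intro continuous_intros continuous_on_subset[OF G(1)]) auto
  qed (use agree in auto)
  moreover have "cball c r \<union> - ball c r = UNIV" by auto
  ultimately have "continuous_on UNIV \<psi>" by simp
  moreover have "\<psi> z \<noteq> 0" if "z \<in> cball c r" for z
    using that by (simp add: \<psi>_def)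
  moreover have "\<psi> z = \<phi> z * (z - c) powi (- n)" if "z \<notin> ball c r" for z
    using that agree[of z] by (auto simp: \<psi>_def)
  ultimately show thesis using that by blast
qed

text \<open>
  The zeros are removed one at a time: inside a small circle around a zero, \<open>\<phi>\<close> is replaced by the
  exponential of a Tietze extension of the logarithm of \<open>\<phi> z * (z - c) powi (- n)\<close>.
\<close>

lemma circle_index_at_infinity_le_card_zeros:
  assumes "continuous_on UNIV \<phi>" "finite {z. \<phi> z = 0}" "\<And>c. \<phi> c = 0 \<Longrightarrow> zero_index_le_one \<phi> c"
  shows "\<exists>N. N \<le> int (card {z. \<phi> z = 0}) \<and> (\<forall>\<^sub>F R in at_top. circle_index \<phi> 0 R N)"
  using assms
proof (induction "card {z. \<phi> z = 0}" arbitrary: \<phi>)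
  case 0
  then have "circle_index \<phi> 0 R 0" for R
    by (intro circle_index_cball continuous_on_subset[OF 0(2)]) auto
  then show ?case by (intro exI[of _ 0]) auto
next
  case (Suc k)
  then have "{z. \<phi> z = 0} \<noteq> {}" by force
  then obtain c where c: "\<phi> c = 0" by auto
  have "c islimpt {z. \<phi> z = 0} \<longleftrightarrow> False"
    using Suc.prems(2) by (simp add: islimpt_finite)
  then obtain \<epsilon> where \<epsilon>: "\<epsilon> > 0" "\<And>z. \<phi> z = 0 \<Longrightarrow> z \<noteq> c \<Longrightarrow> \<epsilon> \<le> dist c z"
    by (auto simp: islimpt_approachable dist_commute not_less)
  obtain r n where r: "0 < r" "r < \<epsilon>" "n \<le> 1" "circle_index \<phi> c r n"
    using Suc.prems(3)[OF c] \<epsilon>(1) unfolding zero_index_le_one_def by blast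
  obtain \<psi> where \<psi>: "continuous_on UNIV \<psi>" "\<And>z. z \<in> cball c r \<Longrightarrow> \<psi> z \<noteq> 0"
    "\<And>z. z \<notin> ball c r \<Longrightarrow> \<psi> z = \<phi> z * (z - c) powi (- n)"
    by (rule circle_index_extend[OF Suc.prems(1) r(4,1)]) (use \<epsilon>(2) r in force)+
  have zeros: "{z. \<psi> z = 0} = {z. \<phi> z = 0} - {c}"
  proof (intro set_eqI)
    fix z show "z \<in> {z. \<psi> z = 0} \<longleftrightarrow> z \<in> {z. \<phi> z = 0} - {c}"
    proof (cases "z \<in> cball c r")
      case True
      then show ?thesis using \<psi>(2)[OF True] \<epsilon>(2)[of z] r by force
    next
      case False
      then have "z \<noteq> c" using r by auto
      then show ?thesis using \<psi>(3)[of z] False by (auto simp: power_int_eq_0_iff)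
    qed
  qed
  have card: "card {z. \<psi> z = 0} = k" "finite {z. \<psi> z = 0}"
    using Suc.hyps(2) Suc.prems(2) c by (simp_all add: zeros)
  \<comment> \<open>Another zero \<open>d\<close> lies outside the removed disc, and on
    \<open>cball d (dist c d - r)\<close> the functions \<open>\<psi>\<close> and
    \<open>\<phi>\<close> differ by a zero-free factor.\<close>
  have "zero_index_le_one \<psi> d" if "\<psi> d = 0" for d
  proof (rule zero_index_le_one_transfer)
    have d: "\<phi> d = 0" "d \<noteq> c" using that zeros by auto
    show "zero_index_le_one \<phi> d" by (rule Suc.prems(3)[OF d(1)])
    show "0 < dist c d - r" using \<epsilon>(2)[OF d] r by auto
    have far: "z \<notin> ball c r" if "z \<in> cball d (dist c d - r)" for z
      using that dist_triangle[of c d z] by (simp add: dist_commute)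
    then have "z \<noteq> c" if "(z::complex) \<in> cball d (dist c d - r)" for z
      using that r by force
    then show "continuous_on (cball d (dist c d - r)) (\<lambda>z. (z - c) powi (- n))"
      "\<And>z. z \<in> cball d (dist c d - r) \<Longrightarrow> (z - c) powi (- n) \<noteq> 0"
      by (auto intro!: continuous_intros simp: power_int_eq_0_iff)
    show "\<psi> z = \<phi> z * (z - c) powi (- n)" if "z \<in> cball d (dist c d - r)" for z
      using \<psi>(3)[OF far[OF that]] .
  qed
  then obtain N where N: "N \<le> int (card {z. \<psi> z = 0})" "\<forall>\<^sub>F R in at_top. circle_index \<psi> 0 R N"
    using Suc.hyps(1)[of \<psi>] card \<psi>(1) by blast
  \<comment> \<open>Circles of radius above \<open>cmod c + r\<close> surround the removed disc;
    putting back \<open>(z - c) powi n\<close> changes the index by \<open>n\<close>.\<close>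
  have "\<forall>\<^sub>F R in at_top. circle_index \<phi> 0 R (N + n)"
    using N(2) eventually_gt_at_top[of "cmod c + r"]
  proof eventually_elim
    case (elim R)
    have cR: "cmod c < R" and R: "0 < R"
      using elim r norm_ge_zero[of c] by linarith+
    have "circle_index (\<lambda>z. \<psi> z * (z - c) powi n) 0 R (N + n)"
      by (intro circle_index_mult circle_index_shift elim cR R)
    then show ?case
    proof (rule circle_index_cong)
      fix z :: complex assume z: "z \<in> sphere 0 R"
      then have "z \<notin> ball c r"
        using elim norm_triangle_ineq[of "z - c" c] by (auto simp: dist_norm norm_minus_commute)
      moreover from this have "z - c \<noteq> 0" using r by auto
      ultimately show "\<phi> z = \<psi> z * (z - c) powi n"
        using \<psi>(3)[of z] by (simp add: power_int_minus)
    qed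
  qed
  moreover have "N + n \<le> int (card {z. \<phi> z = 0})"
    using N(1) card Suc.hyps(2) r(3) by linarith
  ultimately show ?case by blast
qed

section \<open>Local index at a zero of \<open>cnj z * poly Q z - poly P z\<close>\<close>

text \<open>The mean value inequality is applied on a disc to \<open>f z - f' c * z\<close>, whose
  derivative is small by continuity of \<open>f'\<close>. The estimate covers all pairs
  \<open>z\<close>, \<open>w\<close>, as needed to compare two zeros on the same circle.\<close>

lemma strict_derivative:
  fixes f f' :: "complex \<Rightarrow> complex"
  assumes "open S" "c \<in> S" "continuous_on S f'" "0 < \<epsilon>"
    and der: "\<And>z. z \<in> S \<Longrightarrow> (f has_field_derivative f' z) (at z)"
  obtains \<delta> where "0 < \<delta>" "cball c \<delta> \<subseteq> S"
    "\<And>z w. z \<in> cball c \<delta> \<Longrightarrow> w \<in> cball c \<delta> \<Longrightarrow> cmod (f z - f w - f' c * (z - w)) \<le> \<epsilon> * cmod (z - w)"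
proof -
  obtain d1 where d1: "0 < d1" "cball c d1 \<subseteq> S"
    using assms(1,2) open_contains_cball by blast
  obtain d2 where d2: "0 < d2" "\<And>z. z \<in> S \<Longrightarrow> dist z c < d2 \<Longrightarrow> dist (f' z) (f' c) < \<epsilon>"
    using assms(2-4) unfolding continuous_on_iff by meson
  define \<delta> where "\<delta> = min d1 (d2 / 2)"
  have \<delta>: "0 < \<delta>" "\<delta> \<le> d1" "\<delta> < d2" using d1 d2 by (auto simp: \<delta>_def)
  then have sub: "cball c \<delta> \<subseteq> S" using d1(2) by force
  have "cmod (f z - f w - f' c * (z - w)) \<le> \<epsilon> * cmod (z - w)"
    if "z \<in> cball c \<delta>" "w \<in> cball c \<delta>" for z w
  proof -
    have "cmod ((f z - f' c * z) - (f w - f' c * w)) \<le> \<epsilon> * cmod (z - w)"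
    proof (rule field_differentiable_bound[OF convex_cball _ _ that, where f = "\<lambda>z. f z - f' c * z"])
      fix u assume u: "u \<in> cball c \<delta>"
      then show "((\<lambda>z. f z - f' c * z) has_field_derivative (f' u - f' c)) (at u within cball c \<delta>)"
        using sub by (auto intro!: derivative_eq_intros has_field_derivative_at_within[OF der])
      show "cmod (f' u - f' c) \<le> \<epsilon>"
        using d2(2)[of u] u sub \<delta> by (force simp: dist_norm norm_minus_commute)
    qed
    then show ?thesis by (simp add: algebra_simps)
  qed
  then show thesis using that \<delta>(1) sub by blast
qed

text \<open>Near \<open>c\<close>, \<open>K z\<close> is \<open>poly Q z\<close> times
  \<open>cnj z - f z\<close>. The real derivative of the latter at \<open>c\<close> is
  \<open>cnj u - f' c * u\<close>, and \<open>l\<close> times this has real part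
  \<open>Re (\<mu> * u)\<close>.\<close>

lemma zero_index_le_one_cnj_poly:
  fixes P Q :: "complex poly"
  defines "K \<equiv> \<lambda>z. cnj z * poly Q z - poly P z"
  assumes "K c = 0" "poly Q c \<noteq> 0" "finite {z. K z = 0}"
  shows "zero_index_le_one K c"
  unfolding zero_index_le_one_def
proof (intro allI impI)
  fix \<epsilon> :: real assume "\<epsilon> > 0"
  define f where "f \<equiv> \<lambda>z. poly P z / poly Q z"
  define f' where "f' \<equiv> \<lambda>z. (poly (pderiv P) z * poly Q z - poly P z * poly (pderiv Q) z) / (poly Q z * poly Q z)"
  define S where "S = {z. poly Q z \<noteq> 0}"
  have contK: "continuous_on A K" for A
    unfolding K_def by (intro continuous_intros)
  have S: "open S"
    unfolding S_def by (intro open_Collect_neq continuous_intros)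
  \<comment> \<open>\<open>l = 1\<close> makes \<open>\<mu>\<close> nonzero unless
    \<open>f' c = 1\<close>; then \<open>l = \<i>\<close> gives \<open>- 2 * \<i>\<close>.\<close>
  obtain l where l: "cmod l = 1" "cnj l - l * f' c \<noteq> 0"
  proof (cases "f' c = 1")
    case True
    then show thesis by (intro that[of \<i>]) auto
  qed (intro that[of 1], auto)
  define \<mu> where "\<mu> = cnj l - l * f' c"
  have "\<mu> \<noteq> 0" using l by (simp add: \<mu>_def)
  obtain \<delta> where \<delta>: "0 < \<delta>" "cball c \<delta> \<subseteq> S"
    "\<And>z w. z \<in> cball c \<delta> \<Longrightarrow> w \<in> cball c \<delta> \<Longrightarrow> cmod (f z - f w - f' c * (z - w)) \<le> cmod \<mu> / 2 * cmod (z - w)"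
  proof (rule strict_derivative[OF S, of c f' "cmod \<mu> / 2" f])
    show "c \<in> S" using assms(3) by (simp add: S_def)
    show "continuous_on S f'"
      unfolding f'_def by (intro continuous_intros) (auto simp: S_def)
    show "(f has_field_derivative f' z) (at z)" if "z \<in> S" for z
      unfolding f_def f'_def using that by (intro DERIV_divide poly_DERIV) (auto simp: S_def)
    show "0 < cmod \<mu> / 2" using \<open>\<mu> \<noteq> 0\<close> by simp
  qed auto
  have "\<not> c islimpt {z. K z = 0}"
    using assms(4) by (simp add: islimpt_finite)
  then obtain e where e: "e > 0" "\<And>z. K z = 0 \<Longrightarrow> z \<noteq> c \<Longrightarrow> e \<le> dist c z"
    by (auto simp: islimpt_approachable dist_commute not_less)
  define r where "r = min \<epsilon> (min \<delta> e) / 2"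
  have r: "0 < r" "r < \<epsilon>" "r < \<delta>" "r < e"
    using \<open>\<epsilon> > 0\<close> \<delta>(1) e(1) by (auto simp: r_def)
  have "K z \<noteq> 0" if "z \<in> sphere c r" for z
    using e(2)[of z] that r by force
  then obtain n where n: "circle_index K c r n"
    using circle_index_exists[of c r K] contK r(1) by blast
  define h where "h \<equiv> \<lambda>z. l * (cnj z - f z)"
  have "circle_index (\<lambda>z. l / poly Q z) c r 0"
    using \<delta>(2) r l(1) by (intro circle_index_cball continuous_intros) (force simp: S_def)+
  then have "circle_index (\<lambda>z. K z * (l / poly Q z)) c r (n + 0)"
    by (intro circle_index_mult n r)
  then have "circle_index h c r n"
    unfolding add_0_right
  proof (rule circle_index_cong)
    fix z assume "z \<in> sphere c r"
    then have "poly Q z \<noteq> 0" using \<delta>(2) r by (force simp: S_def)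
    then show "h z = K z * (l / poly Q z)"
      by (simp add: h_def K_def f_def field_simps)
  qed
  have "n \<le> 1"
  proof (rule circle_index_le_one[OF _ \<open>\<mu> \<noteq> 0\<close> r(1) _ \<open>circle_index h c r n\<close>])
    show "h c = 0"
      using assms(2,3) by (simp add: h_def K_def f_def field_simps)
    fix z w assume "z \<in> cball c r" "w \<in> cball c r"
    then have zw: "z \<in> cball c \<delta>" "w \<in> cball c \<delta>" using r by auto
    \<comment> \<open>Moving the conjugation onto the constant leaves only the linearization error
      of \<open>f\<close>.\<close>
    have "Re (l * cnj u) = Re (cnj l * u)" for u
      by simp
    from this[of "z - w"] have "Re (h z - h w) - Re (\<mu> * (z - w)) = - Re (l * (f z - f w - f' c * (z - w)))"
      by (simp add: h_def \<mu>_def algebra_simps)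
    then have "\<bar>Re (h z - h w) - Re (\<mu> * (z - w))\<bar> \<le> cmod (l * (f z - f w - f' c * (z - w)))"
      by (metis abs_Re_le_cmod abs_minus_cancel)
    also have "\<dots> \<le> cmod \<mu> / 2 * cmod (z - w)"
      using \<delta>(3)[OF zw] by (simp add: norm_mult l(1))
    finally show "\<bar>Re (h z - h w) - Re (\<mu> * (z - w))\<bar> \<le> cmod \<mu> / 2 * cmod (z - w)" .
  qed
  then show "\<exists>r n. 0 < r \<and> r < \<epsilon> \<and> n \<le> 1 \<and> circle_index K c r n"
    using r n by blast
qed

section \<open>Counting zeros on a large circle\<close>

text \<open>On the circle \<open>cnj z = R\<^sup>2 / z\<close>, so the conjugate lowers the exponent
  by one.\<close>

lemma circle_index_cnj_power:
  assumes "0 < R"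
  shows "circle_index (\<lambda>z. cnj z * z ^ m) 0 R (int m - 1)"
proof -
  have "circle_index (\<lambda>z. (z - 0) powi (int m - 1) * of_real (R\<^sup>2)) 0 R (int m - 1 + 0)"
    using assms by (intro circle_index_mult circle_index_powi circle_index_const) auto
  then have "circle_index (\<lambda>z. cnj z * z ^ m) 0 R (int m - 1 + 0)"
  proof (rule circle_index_cong)
    fix z :: complex assume "z \<in> sphere 0 R"
    then have z: "z \<noteq> 0" "of_real (R\<^sup>2) = z * cnj z"
      using assms complex_norm_square[of z] by auto
    show "cnj z * z ^ m = (z - 0) powi (int m - 1) * of_real (R\<^sup>2)"
      unfolding z(2) using z(1) by (simp add: power_int_diff)
  qed
  then show ?thesis by simp
qed

text \<open>The index on one large circle is computed twice: as \<open>N\<close>, bounded by the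
  number of zeros, and as \<open>int m - 1\<close>, read off from the leading behaviour
  \<open>L * cnj z * z ^ m\<close>.\<close>

lemma card_zeros_cnj_poly_ge:
  fixes P Q :: "complex poly"
  defines "K \<equiv> \<lambda>z. cnj z * poly Q z - poly P z"
  assumes no_common: "\<And>z. poly Q z = 0 \<Longrightarrow> poly P z \<noteq> 0"
    and fin: "finite {z. K z = 0}"
    and lim: "((\<lambda>z. K z / (cnj z * z ^ m)) \<longlongrightarrow> L) at_infinity" and "L \<noteq> 0"
  shows "int m - 1 \<le> int (card {z. K z = 0})"
proof -
  have contK: "continuous_on A K" for A
    unfolding K_def by (intro continuous_intros)
  \<comment> \<open>If \<open>poly Q c\<close> were 0, then \<open>K c = 0\<close> would make
    \<open>c\<close> a common zero of \<open>P\<close> and \<open>Q\<close>.\<close>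
  have "zero_index_le_one K c" if "K c = 0" for c
    unfolding K_def
    by (rule zero_index_le_one_cnj_poly) (use that fin no_common[of c] in \<open>auto simp: K_def\<close>)
  then obtain N where N: "N \<le> int (card {z. K z = 0})" "\<forall>\<^sub>F R in at_top. circle_index K 0 R N"
    using circle_index_at_infinity_le_card_zeros[OF contK fin] by blast
  obtain B where B: "\<And>z. B \<le> cmod z \<Longrightarrow> cmod (K z / (cnj z * z ^ m) - L) < cmod L"
    using tendstoD[OF lim, of "cmod L"] \<open>L \<noteq> 0\<close> by (auto simp: eventually_at_infinity dist_norm)
  have "\<forall>\<^sub>F R in at_top. circle_index K 0 R N \<and> max B 0 < R"
    using N(2) eventually_gt_at_top by (rule eventually_conj)
  then have "\<exists>R. circle_index K 0 R N \<and> max B 0 < R"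
    by (rule eventually_happens'[OF trivial_limit_at_top_linorder])
  then obtain R where R: "circle_index K 0 R N" "B < R" "0 < R"
    by auto
  have "circle_index (\<lambda>z. K z / (cnj z * z ^ m)) 0 R 0"
    using B R by (intro circle_index_near_const[where L = L] continuous_intros contK) auto
  then have "circle_index (\<lambda>z. cnj z * z ^ m * (K z / (cnj z * z ^ m))) 0 R (int m - 1 + 0)"
    using R by (intro circle_index_mult circle_index_cnj_power)
  then have "circle_index K 0 R (int m - 1 + 0)"
    by (rule circle_index_cong) (use R in auto)
  then have "N = int m - 1 + 0"
    by (rule circle_index_unique[OF R(1) _ R(3)])
  then show ?thesis
    using N(1) by simp
qed

section \<open>Moving a point to infinity\<close>

text \<open>\<open>reflect_poly\<close> reverses with respect to the actual degree; for
  \<open>degree p \<le> m\<close> the monomial adjusts this to the formal degree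
  \<open>m\<close>.\<close>

definition reverse_poly :: "nat \<Rightarrow> complex poly \<Rightarrow> complex poly" where
  "reverse_poly m p = monom 1 (m - degree p) * reflect_poly p"

lemma poly_reverse_poly:
  assumes "degree p \<le> m" "z \<noteq> 0"
  shows "poly (reverse_poly m p) z = z ^ m * poly p (inverse z)"
  using assms by (simp add: reverse_poly_def poly_monom poly_reflect_poly_nz flip: power_add mult.assoc)

lemma poly_reverse_poly_0:
  assumes "degree p \<le> m"
  shows "poly (reverse_poly m p) 0 = coeff p m"
  using assms by (auto simp: reverse_poly_def poly_monom power_0_left coeff_eq_0)

theorem proposition5p1:
  fixes f :: "ext_complex \<Rightarrow> ext_complex" and m :: nat
  assumes "rational_function_of_degree f m"
    and "m \<ge> 2"
  shows "infinite (E_set f) \<or> card (E_set f) \<ge> m - 1"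
proof (cases "finite (E_set f)")
  case True
  obtain P Q where Q: "Q \<noteq> 0" and cop: "coprime P Q" and m: "m = max (degree P) (degree Q)"
    and f: "f = Defs.quotient_map P Q"
    using assms(1) unfolding rational_function_of_degree_def by blast
  have no_common: "poly P z \<noteq> 0" if "poly Q z = 0" for z
    using coprime_poly_0[OF cop, of z] that by auto
  obtain a where a: "Some a \<notin> E_set f"
  proof -
    have "infinite (range (Some :: complex \<Rightarrow> ext_complex))"
      by (simp add: finite_image_iff infinite_UNIV_char_0)
    then show thesis
      using True that by (metis finite_subset image_subsetI)
  qed
  \<comment> \<open>\<open>Pr\<close> and \<open>Qr\<close> are the numerator and denominator of
    \<open>f (a + 1 / z)\<close>, both multiplied by \<open>z ^ m\<close>.\<close>
  define Pr where "Pr = reverse_poly m (P \<circ>\<^sub>p [:a, 1:])"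
  define Qr where "Qr = reverse_poly m (Q \<circ>\<^sub>p [:a, 1:])"
  \<comment> \<open>With \<open>w = a + 1 / z\<close>, the equation \<open>f w = cnj w\<close> reads
    \<open>Pr / Qr = cnj a + 1 / cnj z\<close>, or \<open>cnj z * Q' = Qr\<close> without
    denominators. So \<open>Qr\<close> takes the place of \<open>P\<close> in the count.\<close>
  define Q' where "Q' = Pr - smult (cnj a) Qr"
  define K where "K \<equiv> \<lambda>z. cnj z * poly Q' z - poly Qr z"
  have deg: "degree (P \<circ>\<^sub>p [:a, 1:]) = degree P" "degree (Q \<circ>\<^sub>p [:a, 1:]) = degree Q"
    by (simp_all add: degree_pcompose)
  have Pr: "poly Pr z = z ^ m * poly P (a + inverse z)"
    and Qr: "poly Qr z = z ^ m * poly Q (a + inverse z)" if "z \<noteq> 0" for z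
    using that m deg by (simp_all add: Pr_def Qr_def poly_reverse_poly poly_pcompose)
  \<comment> \<open>At \<open>0\<close> the values are the coefficients of degree \<open>m\<close>;
    they do not both vanish, as \<open>m\<close> is the larger degree.\<close>
  have P0: "poly Pr 0 = 0 \<longleftrightarrow> degree P < m" and Q0: "poly Qr 0 = 0 \<longleftrightarrow> degree Q < m"
  proof -
    have "coeff p m = 0 \<longleftrightarrow> degree p < m" if "degree p \<le> m" "m > 0" for p :: "complex poly"
      using that by (metis coeff_eq_0 degree_0 leading_coeff_0_iff le_neq_implies_less less_irrefl)
    then show "poly Pr 0 = 0 \<longleftrightarrow> degree P < m" "poly Qr 0 = 0 \<longleftrightarrow> degree Q < m"
      using deg m \<open>m \<ge> 2\<close> by (simp_all add: Pr_def Qr_def poly_reverse_poly_0)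
  qed
  have K_eq: "K z = cnj z * z ^ m * (poly P (a + inverse z) - cnj (a + inverse z) * poly Q (a + inverse z))"
    if "z \<noteq> 0" for z
    using that by (simp add: K_def Q'_def Pr Qr field_simps)
  have E_iff: "Some z \<in> E_set f \<longleftrightarrow> poly P z - cnj z * poly Q z = 0" for z
    using no_common[of z] by (auto simp: E_set_def f Defs.quotient_map_def ext_cnj_def field_simps)
  have E_inf: "None \<in> E_set f \<longleftrightarrow> poly Qr 0 = 0"
    using m by (auto simp: E_set_def f Defs.quotient_map_def ext_cnj_def Q0)
  \<comment> \<open>The coordinate change sends \<open>0\<close> to infinity and omits the value
    \<open>a\<close>, which corresponds to \<open>z\<close> at infinity.\<close>
  define J where "J \<equiv> \<lambda>z. if z = 0 then None else Some (a + inverse z)"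
  have "inj J"
    by (auto simp: inj_def J_def)
  have "J z \<in> E_set f" if "K z = 0" for z
  proof (cases "z = 0")
    case True
    then show ?thesis using that by (simp add: J_def E_inf K_def)
  next
    case False
    then show ?thesis using that by (simp add: J_def E_iff K_eq)
  qed
  then have J: "J ` {z. K z = 0} \<subseteq> E_set f" by auto
  then have fin: "finite {z. K z = 0}"
    using True \<open>inj J\<close> by (metis finite_imageD finite_subset inj_on_subset subset_UNIV)
  have "int m - 1 \<le> int (card {z. K z = 0})"
    unfolding K_def
  proof (rule card_zeros_cnj_poly_ge)
    show "poly Qr z \<noteq> 0" if "poly Q' z = 0" for z
    proof
      assume Qr0: "poly Qr z = 0"
      then have Pr0: "poly Pr z = 0" using that by (simp add: Q'_def)
      show False
      proof (cases "z = 0")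
        case True
        then show False using Pr0 Qr0 P0 Q0 m by auto
      next
        case False
        then show False using Pr0 Qr0 no_common by (simp add: Pr Qr)
      qed
    qed
    show "finite {z. cnj z * poly Q' z - poly Qr z = 0}"
      using fin by (simp add: K_def)
    \<comment> \<open>As \<open>z\<close> tends to infinity, \<open>a + 1 / z\<close> tends to
      \<open>a\<close>; the limit is nonzero by the choice of \<open>a\<close>.\<close>
    have "((\<lambda>z. poly P (a + inverse z) - cnj (a + inverse z) * poly Q (a + inverse z)) \<longlongrightarrow>
        poly P (a + 0) - cnj (a + 0) * poly Q (a + 0)) at_infinity"
      by (intro tendsto_intros tendsto_inverse_0)
    then show "((\<lambda>z. (cnj z * poly Q' z - poly Qr z) / (cnj z * z ^ m)) \<longlongrightarrow>
        poly P a - cnj a * poly Q a) at_infinity"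
    proof (rule Lim_transform_eventually[THEN tendsto_eq_rhs])
      show "\<forall>\<^sub>F z in at_infinity. poly P (a + inverse z) - cnj (a + inverse z) * poly Q (a + inverse z) =
          (cnj z * poly Q' z - poly Qr z) / (cnj z * z ^ m)"
        using eventually_not_equal_at_infinity[of 0]
        by eventually_elim (use K_eq in \<open>auto simp: K_def\<close>)
    qed simp
    show "poly P a - cnj a * poly Q a \<noteq> 0"
      using a by (simp add: E_iff)
  qed
  also have "card {z. K z = 0} \<le> card (E_set f)"
    by (rule card_inj_on_le[OF _ J True]) (use \<open>inj J\<close> in \<open>auto intro: inj_on_subset\<close>)
  finally show ?thesis by linarith
qed simp

end
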